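(* Let $f:\mathbb{R}^m\to\mathbb{R}\cup\{+\infty\}$ be a lower semicontinuous, convex and bounded below function, let $x_0\in\mathrm{dom}(f)$ with $\partial f(x_0)\neq\emptyset$, and let $\Omega:=\{x\in\mathbb{R}^m: f(x)\le f(x_0)\}$. Suppose that $\Omega$ is bounded and that $\partial f$ is locally Lipschitzian on $\Omega$ (i.e. at every point of $\Omega$). Let the sequence $\{x_n:n=0,1,\dots\}$ be generated by Algorithm NSDM started at $x_0$. Then there exists a subsequence $\{x_{n_k}\}$ of $\{x_n\}$ that converges to a point $\bar x\in\Omega$ with $0\in\partial f(\bar x)$, and consequently $f(\bar x)=\min_{z\in\mathbb{R}^m}f(z)$.
   Context: $\mathbb{R}^m$ carries the Euclidean inner product and norm; $B(x,r)$ is the open ball with center $x$ and radius $r$; $B_{\mathbb{R}^m}$ is the closed unit ball; $\mathrm{dom}(f):=\{y: f(y)<+\infty\}$. For the convex function $f$ and $x\in\mathrm{dom}(f)$, $\partial f(x)=\{\zeta\in\mathbb{R}^m:\langle\zeta,y-x\rangle\le f(y)-f(x)\ \ \forall y\in\mathbb{R}^m\}$ is the subdifferential of convex analysis (for convex lower semicontinuous $f$ the proximal subdifferential $\partial_p f(x)$ and the limiting subdifferential both coincide with it); $\partial f(x)=\emptyset$ for $x\notin\mathrm{dom}(f)$. Local Lipschitz property: a set-valued mapping $F:\mathbb{R}^m\rightrightarrows\mathbb{R}^m$ is locally Lipschitzian at $x$ (where $F(x)\ne\emptyset$) iff there exist $\delta,\kappa>0$ such that $F(x')\subset F(x'')+\kappa\|x'-x''\|B_{\mathbb{R}^m}$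 for all $x',x''\in B(x,\delta)$. Algorithm NSDM (for convex $f$). Start from $x_0$ with $\partial f(x_0)\neq\emptyset$. For $n=1,2,\dots$: choose any $v_{n-1}\in\partial f(x_{n-1})$. If $v_{n-1}=0$, terminate. Otherwise set $u_{n-1}:=-v_{n-1}/\|v_{n-1}\|$ and $x_n:=x_{n-1}+\varepsilon_{n-1}u_{n-1}$, where $\varepsilon_{n-1}\ge 0$ is chosen such that $f(x_{n-1}+\varepsilon_{n-1}u_{n-1})=\min_{t\ge0}f(x_{n-1}+tu_{n-1})$. Convention: if the algorithm terminates at $x_{n-1}$, the sequence is continued by $x_k:=x_{n-1}$ for all $k\ge n$. *)

theory Defs
  imports "HOL-Analysis.Analysis"
begin

text \<open>Functions with values in the reals extended by plus infinity are \<^typ>\<open>ereal\<close>-valued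
  functions that never take the value minus infinity; the latter is required explicitly by
  the users of the definitions below.\<close>

definition edom :: "('a \<Rightarrow> ereal) \<Rightarrow> 'a set" where
  "edom f = {y. f y < \<infinity>}"

text \<open>The library's \<^const>\<open>convex_on\<close> is restricted to real-valued functions. At the end points
  the convention \<open>0 * \<infinity> = 0\<close> of \<^typ>\<open>ereal\<close> makes the inequality trivial.\<close>

definition econvex :: "('a::real_vector \<Rightarrow> ereal) \<Rightarrow> bool" where
  "econvex f \<longleftrightarrow> (\<forall>x y. \<forall>t\<in>{0..1::real}.
     f ((1 - t) *\<^sub>R x + t *\<^sub>R y) \<le> ereal (1 - t) * f x + ereal t * f y)"

text \<open>\<^term>\<open>Liminf (at x) f\<close> ranges over punctured neighbourhoods of \<open>x\<close>, which makes no
  difference for the inequality.\<close>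

definition lower_semicontinuous :: "('a::topological_space \<Rightarrow> ereal) \<Rightarrow> bool" where
  "lower_semicontinuous f \<longleftrightarrow> (\<forall>x. f x \<le> Liminf (at x) f)"

definition subdifferential :: "('a::real_inner \<Rightarrow> ereal) \<Rightarrow> 'a \<Rightarrow> 'a set" where
  "subdifferential f x =
     (if x \<in> edom f then {\<zeta>. \<forall>y. ereal (inner \<zeta> (y - x)) \<le> f y - f x} else {})"

definition locally_Lipschitzian_at :: "('a::real_normed_vector \<Rightarrow> 'a set) \<Rightarrow> 'a \<Rightarrow> bool" where
  "locally_Lipschitzian_at F x \<longleftrightarrow> F x \<noteq> {} \<and>
     (\<exists>\<delta>>0. \<exists>\<kappa>>0. \<forall>x'\<in>ball x \<delta>. \<forall>x''\<in>ball x \<delta>.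
        F x' \<subseteq> {w + (\<kappa> * norm (x' - x'')) *\<^sub>R b | w b. w \<in> F x'' \<and> b \<in> cball 0 1})"

text \<open>One step with chosen subgradient \<open>v\<close> (nonzero) and step length \<open>\<epsilon>\<close>, leading from \<open>x\<close>
  to \<open>x'\<close>. That the infimum of \<open>f\<close> along the ray is attained, i.e. is a minimum, is expressed
  by the equation itself.\<close>

definition nsdm_step :: "('a::real_inner \<Rightarrow> ereal) \<Rightarrow> 'a \<Rightarrow> 'a \<Rightarrow> real \<Rightarrow> 'a \<Rightarrow> bool" where
  "nsdm_step f x v \<epsilon> x' \<longleftrightarrow>
     (let u = - (v /\<^sub>R norm v) in
        x' = x + \<epsilon> *\<^sub>R u \<and> 0 \<le> \<epsilon> \<and>
        f (x + \<epsilon> *\<^sub>R u) = (INF t\<in>{0..}. f (x + t *\<^sub>R u)))"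

text \<open>\<open>v\<close> and \<open>\<epsilon>\<close> record the choices made in the run; their values after termination, i.e. at
  indices beyond the first \<open>i\<close> with \<open>v i = 0\<close>, are irrelevant.\<close>

definition nsdm_sequence :: "('a::real_inner \<Rightarrow> ereal) \<Rightarrow> 'a \<Rightarrow> (nat \<Rightarrow> 'a) \<Rightarrow> bool" where
  "nsdm_sequence f x0 x \<longleftrightarrow> subdifferential f x0 \<noteq> {} \<and> x 0 = x0 \<and>
     (\<exists>v \<epsilon>. \<forall>n.
        if \<exists>i<n. v i = 0 then x (Suc n) = x n
        else v n \<in> subdifferential f (x n) \<and>
             (if v n = 0 then x (Suc n) = x n
              else nsdm_step f (x n) (v n) (\<epsilon> n) (x (Suc n))))"

end

theory Submission
  imports Defs
begin

text \<open>If the algorithm terminates there is nothing to show. Otherwise the values of \<open>f\<close> along the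
  run decrease to a finite limit, and by compactness of the sublevel set a subsequence converges to
  some \<open>xbar\<close>. Near \<open>xbar\<close> the Lipschitz property moves the chosen subgradient \<open>v\<close> at \<open>x\<close> to one
  at \<open>x - s v / |v|\<close> at cost \<open>\<kappa> s\<close>, so each exact line search lowers \<open>f\<close> by at least
  \<open>s |v| - \<kappa> s\<^sup>2\<close> for every small \<open>s > 0\<close>. As the decrements tend to zero, so do the subgradients;
  moved to \<open>xbar\<close> they give elements of the closed set \<open>\<partial>f(xbar)\<close> that tend to zero.\<close>

lemma subgradient_real_le:
  assumes "\<zeta> \<in> subdifferential f x" "f x = ereal a" "f y = ereal b"
  shows "inner \<zeta> (y - x) \<le> b - a"
proof -
  have "ereal (inner \<zeta> (y - x)) \<le> f y - f x"
    using assms(1) by (auto simp: subdifferential_def split: if_splits)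
  then show ?thesis using assms by simp
qed

lemma subdifferential_nonempty_finite:
  assumes "\<zeta> \<in> subdifferential f x" "f x \<noteq> -\<infinity>"
  obtains a where "f x = ereal a"
  using assms by (cases "f x") (auto simp: subdifferential_def edom_def split: if_splits)

lemma zero_subgradient_imp_min:
  assumes "0 \<in> subdifferential f x" "\<And>y. f y \<noteq> -\<infinity>"
  shows "f x = (INF z. f z)"
proof (rule antisym)
  obtain a where a: "f x = ereal a"
    using assms subdifferential_nonempty_finite by metis
  show "f x \<le> (INF z. f z)"
  proof (rule INF_greatest)
    fix y
    have "0 \<le> f y - f x"
      using assms(1) by (auto simp: subdifferential_def zero_ereal_def split: if_splits)
    then show "f x \<le> f y" using a by (cases "f y") auto
  qed
qed (auto intro: INF_lower)

text \<open>For finite \<open>f x\<close> the set is an intersection over \<open>y\<close> of closed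
  half-spaces; a \<open>y\<close> with \<open>f y = \<infinity>\<close> imposes no constraint and
  contributes the whole space.\<close>

lemma closed_subdifferential:
  assumes proper: "\<And>y. f y \<noteq> -\<infinity>"
  shows "closed (subdifferential f x)"
proof (cases "x \<in> edom f")
  case True
  then obtain a where a: "f x = ereal a"
    using proper[of x] by (cases "f x") (auto simp: edom_def)
  have "closed {\<zeta>. ereal (inner \<zeta> (y - x)) \<le> f y - f x}" for y
  proof (cases "f y")
    case (real b)
    have "closed {\<zeta>. inner \<zeta> (y - x) \<le> b - a}"
      by (intro closed_Collect_le continuous_intros)
    then show ?thesis using real a by simp
  qed (use proper[of y] a in auto)
  then have "closed {\<zeta>. \<forall>y. ereal (inner \<zeta> (y - x)) \<le> f y - f x}"
    by (rule closed_Collect_all)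
  then show ?thesis using True by (simp add: subdifferential_def)
qed (simp add: subdifferential_def)

text \<open>The complement is open: \<open>Liminf\<close> controls a punctured neighbourhood of
  \<open>y\<close>, and \<open>y\<close> itself satisfies the strict inequality by
  assumption.\<close>

lemma lower_semicontinuous_closed_sublevel:
  assumes "lower_semicontinuous f"
  shows "closed {y. f y \<le> c}"
proof -
  have "\<exists>T. open T \<and> y \<in> T \<and> T \<subseteq> {y. c < f y}" if "c < f y" for y
  proof -
    have "f y \<le> Liminf (at y) f"
      using assms by (simp add: lower_semicontinuous_def)
    then have "eventually (\<lambda>z. c < f z) (at y)"
      using that by (simp add: le_Liminf_iff)
    then obtain T where "open T" "y \<in> T" "\<forall>z\<in>T. z \<noteq> y \<longrightarrow> c < f z"
      by (auto simp: eventually_at_topological)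
    then show ?thesis using that by (intro exI[of _ T]) auto
  qed
  then have "open {y. c < f y}"
    by (subst open_subopen) simp
  moreover have "- {y. f y \<le> c} = {y. c < f y}" by auto
  ultimately show ?thesis by (simp add: closed_def)
qed

text \<open>A subgradient at \<open>z\<close> bounds \<open>f z'\<close> only from below. An upper
  bound comes from a subgradient \<open>w\<close> at \<open>z'\<close> tested against
  \<open>z\<close>; the inclusion supplies one within \<open>\<kappa> * s\<close> of
  \<open>v\<close>, so that \<open>inner w (z - z')\<close> is at least
  \<open>s * norm v - \<kappa> * s\<^sup>2\<close>.\<close>

lemma subgradient_descent:
  fixes f :: "'a::real_inner \<Rightarrow> ereal"
  assumes proper: "\<And>y. f y \<noteq> -\<infinity>"
    and v: "v \<in> subdifferential f z" "v \<noteq> 0"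
    and s: "0 \<le> s" and \<kappa>: "0 \<le> \<kappa>"
    and z': "z' = z + s *\<^sub>R (- (v /\<^sub>R norm v))"
    and Lip: "subdifferential f z \<subseteq>
      {w + (\<kappa> * norm (z - z')) *\<^sub>R b | w b. w \<in> subdifferential f z' \<and> b \<in> cball 0 1}"
    and a: "f z = ereal a"
  shows "f z' \<le> ereal (a - s * norm v + \<kappa> * s\<^sup>2)"
proof -
  obtain w b where w: "v = w + (\<kappa> * norm (z - z')) *\<^sub>R b" "w \<in> subdifferential f z'"
    and b: "norm b \<le> 1"
    using Lip v(1) by auto
  obtain a' where a': "f z' = ereal a'"
    using w(2) proper subdifferential_nonempty_finite by metis
  have d: "z - z' = (s / norm v) *\<^sub>R v"
    by (simp add: z' divide_inverse)
  have n: "norm (z - z') = s"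
    using v(2) s by (simp add: d)
  have "inner b (z - z') \<le> norm b * norm (z - z')"
    by (rule norm_cauchy_schwarz)
  also have "\<dots> \<le> s"
    using b s by (simp add: n mult_left_le_one_le)
  finally have "(\<kappa> * s) * inner b (z - z') \<le> (\<kappa> * s) * s"
    using \<kappa> s by (intro mult_left_mono) auto
  moreover have "inner v (z - z') = s * norm v"
    using v(2) by (simp add: d power2_norm_eq_inner[symmetric] power2_eq_square)
  moreover have "inner v (z - z') = inner w (z - z') + (\<kappa> * s) * inner b (z - z')"
    using w(1) n by (metis inner_add_left inner_scaleR_left)
  moreover have "inner w (z - z') \<le> a - a'"
    using subgradient_real_le[OF w(2) a' a] .
  ultimately have "a' \<le> a - s * norm v + \<kappa> * s\<^sup>2"
    by (simp add: power2_eq_square algebra_simps)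
  then show ?thesis by (simp add: a')
qed

lemma nsdm_step_le:
  assumes "nsdm_step f x v \<epsilon> x'" "0 \<le> t"
  shows "f x' \<le> f (x + t *\<^sub>R (- (v /\<^sub>R norm v)))"
  using assms by (auto simp: nsdm_step_def Let_def intro: INF_lower)

theorem theorem3p3:
  fixes f :: "real ^ 'm \<Rightarrow> ereal"
    and x0 :: "real ^ 'm"
    and x :: "nat \<Rightarrow> real ^ 'm"
    and \<Omega> :: "(real ^ 'm) set"
  assumes proper: "\<And>y. f y \<noteq> -\<infinity>"
    and lsc: "lower_semicontinuous f"
    and conv: "econvex f"
    and bdd_below: "\<exists>c::real. \<forall>y. ereal c \<le> f y"
    and x0_dom: "x0 \<in> edom f"
    and x0_subdiff: "subdifferential f x0 \<noteq> {}"
    and Omega: "\<Omega> = {y. f y \<le> f x0}"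
    and Omega_bounded: "bounded \<Omega>"
    and Lipschitz: "\<And>y. y \<in> \<Omega> \<Longrightarrow> locally_Lipschitzian_at (subdifferential f) y"
    and run: "nsdm_sequence f x0 x"
  shows "\<exists>r xbar. strict_mono r \<and> (x \<circ> r) \<longlonglongrightarrow> xbar \<and> xbar \<in> \<Omega> \<and>
           0 \<in> subdifferential f xbar \<and> f xbar = (INF z. f z)"
proof -
  obtain v \<epsilon> where x_0: "x 0 = x0" and vrun: "\<And>n.
        if \<exists>i<n. v i = 0 then x (Suc n) = x n
        else v n \<in> subdifferential f (x n) \<and>
             (if v n = 0 then x (Suc n) = x n
              else nsdm_step f (x n) (v n) (\<epsilon> n) (x (Suc n)))"
    using run unfolding nsdm_sequence_def by auto
  \<comment> \<open>The step length 0 competes in the line search; after termination the iterates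
    are constant.\<close>
  have dec: "f (x (Suc n)) \<le> f (x n)" for n
    using vrun[of n] nsdm_step_le[of f "x n" "v n" "\<epsilon> n" "x (Suc n)" 0]
    by (auto split: if_splits)
  have in_Omega: "x n \<in> \<Omega>" for n
    by (induction n) (use dec x_0 Omega in \<open>auto intro: order_trans\<close>)
  show ?thesis
  proof (cases "\<exists>i. v i = 0")
    case True
    \<comment> \<open>The first zero is needed, because later values of \<open>v\<close> are
      arbitrary and need not be subgradients.\<close>
    then obtain i where vi: "v i = 0" and least: "\<forall>j<i. v j \<noteq> 0"
      using exists_least_iff[of "\<lambda>i. v i = 0"] by blast
    have zero: "0 \<in> subdifferential f (x i)" using vrun[of i] vi least by (auto split: if_splits)
    have "x (Suc n) = x n" if "i \<le> n" for n
      using vrun[of n] vi that by (cases "i = n") (auto split: if_splits)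
    then have "x (i + n) = x i" for n by (induction n) auto
    then have "(x \<circ> (\<lambda>n. i + n)) \<longlonglongrightarrow> x i" by (simp add: o_def)
    moreover have "strict_mono (\<lambda>n. i + n)" by (simp add: strict_mono_def)
    ultimately show ?thesis
      using in_Omega zero zero_subgradient_imp_min[OF zero proper] by blast
  next
    case False
    then have v0: "v n \<noteq> 0" and vsub: "v n \<in> subdifferential f (x n)"
      and step: "nsdm_step f (x n) (v n) (\<epsilon> n) (x (Suc n))" for n
      using vrun[of n] by auto
    \<comment> \<open>Every iterate has a subgradient, so \<open>f\<close> is finite there and real
      arithmetic loses nothing.\<close>
    define g where "g n = real_of_ereal (f (x n))" for n
    have g: "f (x n) = ereal (g n)" for n
      using vsub[of n] proper unfolding g_def
      by (metis subdifferential_nonempty_finite real_of_ereal.simps(1))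
    obtain c where c: "ereal c \<le> f y" for y using bdd_below by blast
    have g_dec: "decseq g"
      using dec by (intro decseq_SucI) (simp add: g)
    moreover have "c \<le> g n" for n using c[of "x n"] by (simp add: g)
    ultimately obtain L where L: "g \<longlonglongrightarrow> L"
      using decseq_convergent[of g c] by blast
    \<comment> \<open>Stated along the full sequence, because the successor of \<open>r k\<close>
      need not be an index of the subsequence.\<close>
    have diff: "(\<lambda>n. g n - g (Suc n)) \<longlonglongrightarrow> 0"
      using tendsto_diff[OF L LIMSEQ_Suc[OF L]] by simp
    have "compact \<Omega>"
      using Omega_bounded lower_semicontinuous_closed_sublevel[OF lsc] Omega
      by (simp add: compact_eq_bounded_closed)
    then obtain xbar r where xbar: "xbar \<in> \<Omega>" and r: "strict_mono r"
      and lim: "(x \<circ> r) \<longlonglongrightarrow> xbar"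
      using in_Omega unfolding compact_def by meson
    obtain \<delta> \<kappa> where \<delta>: "\<delta> > 0" and \<kappa>: "\<kappa> > 0"
      and Lip: "\<And>x' x''. x' \<in> ball xbar \<delta> \<Longrightarrow> x'' \<in> ball xbar \<delta> \<Longrightarrow>
        subdifferential f x' \<subseteq>
          {w + (\<kappa> * norm (x' - x'')) *\<^sub>R b | w b. w \<in> subdifferential f x'' \<and> b \<in> cball 0 1}"
      using Lipschitz[OF xbar] unfolding locally_Lipschitzian_at_def by meson
    have near: "eventually (\<lambda>k. dist (x (r k)) xbar < e) sequentially" if "e > 0" for e
      using tendstoD[OF lim that] by simp
    have vlim: "(\<lambda>k. v (r k)) \<longlonglongrightarrow> 0"
    proof (rule tendstoI)
      fix e :: real assume e: "e > 0"
      \<comment> \<open>The first bound keeps a trial step of length \<open>s\<close> inside the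
        Lipschitz ball when it starts within \<open>\<delta> / 2\<close> of \<open>xbar\<close>; the
        second limits the Lipschitz error \<open>\<kappa> * s\<close> to \<open>e / 2\<close>. The
        decrement threshold \<open>s * e / 2\<close> below yields the other \<open>e / 2\<close>
        after division by \<open>s\<close>.\<close>
      define s where "s = min (\<delta> / 2) (e / (2 * \<kappa>))"
      have s: "s > 0" "s \<le> \<delta> / 2" "\<kappa> * s \<le> e / 2"
        using \<delta> e \<kappa> unfolding s_def by (auto simp: min_def field_simps)
      have "eventually (\<lambda>k. g (r k) - g (Suc (r k)) < s * e / 2) sequentially"
        using order_tendstoD(2)[OF LIMSEQ_subseq_LIMSEQ[OF diff r], of "s * e / 2"] s(1) e
        by (simp add: o_def)
      moreover have "eventually (\<lambda>k. dist (x (r k)) xbar < \<delta> / 2) sequentially"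
        by (rule near) (use \<delta> in simp)
      ultimately show "eventually (\<lambda>k. dist (v (r k)) 0 < e) sequentially"
      proof eventually_elim
        case (elim k)
        let ?n = "r k"
        \<comment> \<open>A trial point on the search ray replaces the next iterate, which may lie
          outside the ball since nothing bounds \<open>\<epsilon> ?n\<close> by
          \<open>\<delta>\<close>; exact minimization on the ray makes the next value no larger than
          \<open>f ?z\<close>.\<close>
        let ?z = "x ?n + s *\<^sub>R (- (v ?n /\<^sub>R norm (v ?n)))"
        have "dist ?z (x ?n) = s"
          using s(1) v0 by (simp add: dist_norm)
        then have z: "?z \<in> ball xbar \<delta>"
          using elim(2) s(2) dist_triangle[of ?z xbar "x ?n"]
          unfolding mem_ball by (simp only: dist_commute)
        have xn: "x ?n \<in> ball xbar \<delta>"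
          using elim(2) \<delta> by (simp add: dist_commute)
        have "f ?z \<le> ereal (g ?n - s * norm (v ?n) + \<kappa> * s\<^sup>2)"
          using subgradient_descent[OF proper vsub v0 _ _ refl Lip[OF xn z] g] s(1) \<kappa> by simp
        moreover have "f (x (Suc ?n)) \<le> f ?z"
          using nsdm_step_le[OF step] s(1) by simp
        ultimately have "g (Suc ?n) \<le> g ?n - s * norm (v ?n) + \<kappa> * s\<^sup>2"
          by (metis g ereal_less_eq(3) order_trans)
        then have "s * norm (v ?n) < s * (e / 2) + s * (\<kappa> * s)"
          using elim(1) by (simp add: power2_eq_square algebra_simps)
        then have "s * norm (v ?n) < s * (e / 2 + \<kappa> * s)"
          by (simp only: distrib_left)
        then have "norm (v ?n) < e / 2 + \<kappa> * s"
          using s(1) by simp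
        then show ?case using s(3) by simp
      qed
    qed
    have "0 \<in> closure (subdifferential f xbar)"
      unfolding closure_approachable
    proof (intro allI impI)
      fix e :: real assume e: "e > 0"
      have "eventually (\<lambda>k. dist (v (r k)) 0 < e / 2) sequentially"
        using tendstoD[OF vlim, of "e / 2"] e by simp
      \<comment> \<open>Within \<open>\<delta>\<close> the Lipschitz inclusion applies between
        \<open>x (r k)\<close> and \<open>xbar\<close>; within \<open>e / (2 * \<kappa>)\<close>
        moving the subgradient costs less than \<open>e / 2\<close>.\<close>
      moreover have "eventually (\<lambda>k. dist (x (r k)) xbar < min \<delta> (e / (2 * \<kappa>))) sequentially"
        by (rule near) (use \<delta> e \<kappa> in simp)
      ultimately have "eventually (\<lambda>k. dist (v (r k)) 0 < e / 2 \<and>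
          dist (x (r k)) xbar < min \<delta> (e / (2 * \<kappa>))) sequentially"
        by (rule eventually_conj)
      then obtain k where k: "norm (v (r k)) < e / 2" "dist (x (r k)) xbar < \<delta>"
        "dist (x (r k)) xbar < e / (2 * \<kappa>)"
        unfolding eventually_sequentially by auto
      have "x (r k) \<in> ball xbar \<delta>" "xbar \<in> ball xbar \<delta>"
        using k(2) \<delta> by (auto simp: dist_commute)
      from Lip[OF this] obtain w b where
        w: "v (r k) = w + (\<kappa> * norm (x (r k) - xbar)) *\<^sub>R b" "w \<in> subdifferential f xbar"
        and b: "norm b \<le> 1"
        using vsub[of "r k"] by auto
      have "w = v (r k) - (\<kappa> * norm (x (r k) - xbar)) *\<^sub>R b" using w(1) by simp
      then have "norm w \<le> norm (v (r k)) + norm ((\<kappa> * norm (x (r k) - xbar)) *\<^sub>R b)"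
        by (metis norm_triangle_ineq4)
      also have "norm ((\<kappa> * norm (x (r k) - xbar)) *\<^sub>R b) \<le> \<kappa> * norm (x (r k) - xbar)"
        using b \<kappa> by (simp add: mult_left_le)
      also have "\<dots> < e / 2"
        using k(3) \<kappa> by (simp add: dist_norm field_simps)
      finally have "dist w 0 < e" using k(1) by simp
      then show "\<exists>w\<in>subdifferential f xbar. dist w 0 < e" using w(2) by blast
    qed
    then have zero: "0 \<in> subdifferential f xbar"
      using closed_subdifferential[of f xbar] proper by simp
    show ?thesis
      using r lim xbar zero zero_subgradient_imp_min[OF zero proper] by blast
  qed
qed

end
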